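(* Let $(\phi_t)_{t\ge0}$ be a non-elliptic semigroup of holomorphic functions in the unit disk $\mathbb{D}$ with Koenigs function $h$. Suppose that $\gamma:[0,+\infty)\to\mathbb{D}$ is a backward orbit for $(\phi_t)$ that converges non-tangentially to a point of the unit circle as $t\to+\infty$. Set $\Omega=h(\mathbb{D})$. Then there exists a constant $c\ge1$ such that $$\frac{1}{c}\cdot\delta_\Omega^-(h(\gamma(t)))\le\delta_\Omega^+(h(\gamma(t)))\le c\cdot\delta_\Omega^-(h(\gamma(t)))$$ for all $t\ge0$.
   Context: A semigroup in $\mathbb{D}=\{z\in\mathbb{C}:|z|<1\}$ is a family $(\phi_t)_{t\ge0}$ of holomorphic self-maps of $\mathbb{D}$ such that (i) $\phi_0$ is the identity of $\mathbb{D}$; (ii) $\phi_{t+s}(z)=\phi_t(\phi_s(z))$ for all $z\in\mathbb{D}$ and $t,s\ge0$; (iii) $\lim_{t\to s}\phi_t(z)=\phi_s(z)$ for all $z\in\mathbb{D}$ and $s\ge0$. It is called non-elliptic if, for some (equivalently, every) $t>0$, $\phi_t$ has no fixed point in $\mathbb{D}$. The Koenigs function of a non-elliptic semigroup $(\phi_t)$ is the unique conformal (i.e. injective holomorphic) map $h:\mathbb{D}\to\mathbb{C}$ with $h(0)=0$ such that $\phi_t(z)=h^{-1}(h(z)+t)$ for all $z\in\mathbb{D}$, $t\ge0$. A backward orbit for $(\phi_t)$ is a continuous curve $\gamma:[0,+\infty)\to\mathbb{D}$ such that $\phi_s(\gamma(t))=\gamma(t-s)$ for every $t\in(0,+\infty)$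 and every $s\in[0,t]$. Then $h(\gamma(t))=h(\gamma(0))-t$ for $t\ge0$, and the whole horizontal line $\{h(\gamma(0))+t:t\in\mathbb{R}\}$ lies in $\Omega=h(\mathbb{D})$. The curve $\gamma$ converges non-tangentially to $\sigma\in\partial\mathbb{D}$ if $\gamma(t)\to\sigma$ as $t\to+\infty$ and $\gamma(t)$ lies, for all large $t$, in a Stolz angle $\{z\in\mathbb{D}:|\sigma-z|<M(1-|z|)\}$ for some $M>1$. Given such $\gamma$, put $\partial\Omega^+=\{w\in\partial\Omega:\operatorname{Im}w>\operatorname{Im}h(\gamma(0))\}$ and $\partial\Omega^-=\{w\in\partial\Omega:\operatorname{Im}w<\operatorname{Im}h(\gamma(0))\}$, and for $z\in\Omega$ let $\delta_\Omega^+(z)=\operatorname{dist}(z,\partial\Omega^+)$ and $\delta_\Omega^-(z)=\operatorname{dist}(z,\partial\Omega^-)$ (Euclidean distances; the distance to the empty set is taken to be $+\infty$). *)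

theory Defs
  imports "HOL-Complex_Analysis.Complex_Analysis"
begin

abbreviation unit_disc :: "complex set"
  where "unit_disc \<equiv> ball 0 1"

text \<open>
  The parameter \<open>t\<close> ranges over all reals, but only the values at \<open>t \<ge> 0\<close> and at points
  of the unit disc are constrained or used.
\<close>
definition holo_semigroup :: "(real \<Rightarrow> complex \<Rightarrow> complex) \<Rightarrow> bool" where
  "holo_semigroup \<phi> \<longleftrightarrow>
     (\<forall>t\<ge>0. \<phi> t holomorphic_on unit_disc \<and> \<phi> t ` unit_disc \<subseteq> unit_disc) \<and>
     (\<forall>z\<in>unit_disc. \<phi> 0 z = z) \<and>
     (\<forall>z\<in>unit_disc. \<forall>t\<ge>0. \<forall>s\<ge>0. \<phi> (t + s) z = \<phi> t (\<phi> s z)) \<and>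
     (\<forall>z\<in>unit_disc. \<forall>s\<ge>0. ((\<lambda>t. \<phi> t z) \<longlongrightarrow> \<phi> s z) (at s within {0..}))"

definition non_elliptic_semigroup :: "(real \<Rightarrow> complex \<Rightarrow> complex) \<Rightarrow> bool" where
  "non_elliptic_semigroup \<phi> \<longleftrightarrow>
     holo_semigroup \<phi> \<and> (\<exists>t>0. \<forall>z\<in>unit_disc. \<phi> t z \<noteq> z)"

text \<open>
  The membership \<open>h z + t \<in> h ` unit_disc\<close> is what makes \<open>h\<inverse>(h z + t)\<close> meaningful;
  \<open>inv_into\<close> is total and arbitrary outside the image. For a non-elliptic semigroup there is
  exactly one such \<open>h\<close> up to its values outside the disc.
\<close>
definition is_Koenigs_function ::
  "(real \<Rightarrow> complex \<Rightarrow> complex) \<Rightarrow> (complex \<Rightarrow> complex) \<Rightarrow> bool" where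
  "is_Koenigs_function \<phi> h \<longleftrightarrow>
     h holomorphic_on unit_disc \<and> inj_on h unit_disc \<and> h 0 = 0 \<and>
     (\<forall>z\<in>unit_disc. \<forall>t\<ge>0.
        h z + of_real t \<in> h ` unit_disc \<and>
        \<phi> t z = inv_into unit_disc h (h z + of_real t))"

definition backward_orbit ::
  "(real \<Rightarrow> complex \<Rightarrow> complex) \<Rightarrow> (real \<Rightarrow> complex) \<Rightarrow> bool" where
  "backward_orbit \<phi> \<gamma> \<longleftrightarrow>
     continuous_on {0..} \<gamma> \<and> \<gamma> ` {0..} \<subseteq> unit_disc \<and>
     (\<forall>t>0. \<forall>s\<in>{0..t}. \<phi> s (\<gamma> t) = \<gamma> (t - s))"

definition stolz_angle :: "complex \<Rightarrow> real \<Rightarrow> complex set" where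
  "stolz_angle \<sigma> M = {z \<in> unit_disc. norm (\<sigma> - z) < M * (1 - norm z)}"

definition converges_nontangentially :: "(real \<Rightarrow> complex) \<Rightarrow> complex \<Rightarrow> bool" where
  "converges_nontangentially \<gamma> \<sigma> \<longleftrightarrow>
     (\<gamma> \<longlongrightarrow> \<sigma>) at_top \<and> (\<exists>M>1. \<forall>\<^sub>F t in at_top. \<gamma> t \<in> stolz_angle \<sigma> M)"

text \<open>Boundaries are taken in the finite plane.\<close>
definition upper_boundary :: "complex set \<Rightarrow> complex \<Rightarrow> complex set" where
  "upper_boundary \<Omega> p = {w \<in> frontier \<Omega>. Im w > Im p}"

definition lower_boundary :: "complex set \<Rightarrow> complex \<Rightarrow> complex set" where
  "lower_boundary \<Omega> p = {w \<in> frontier \<Omega>. Im w < Im p}"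

text \<open>
  The library sets \<open>infdist z {} = 0\<close>; here the distance to the empty set is infinite.
\<close>
definition ext_dist :: "complex \<Rightarrow> complex set \<Rightarrow> ereal" where
  "ext_dist z A = (if A = {} then \<infinity> else ereal (infdist z A))"

definition delta_plus :: "complex set \<Rightarrow> complex \<Rightarrow> complex \<Rightarrow> ereal" where
  "delta_plus \<Omega> p z = ext_dist z (upper_boundary \<Omega> p)"

definition delta_minus :: "complex set \<Rightarrow> complex \<Rightarrow> complex \<Rightarrow> ereal" where
  "delta_minus \<Omega> p z = ext_dist z (lower_boundary \<Omega> p)"

end

(*
  Write p = h (gamma 0), so that h (gamma t) = p - t, and let a(t) be the distance from p - t to the
  part of the complement of Omega above the line Im w = Im p. Since Omega + s is contained in Omega
  for s >= 0, a is nonincreasing. Suppose that at some time t the complement below the line is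
  much farther away than a(t). Then shortly after t there is a stretch of length 4 n d on which a
  stays between d/2 and d, and a disc of radius 8 n^2 d, lying almost entirely below the line, fits
  into Omega and contains n + 1 points of the stretch at mutual distances at least d.

  By Harnack's inequality on that disc, the preimages u_j of these points have 1 - |u_j| comparable
  up to a factor polynomial in n. On the other hand Omega omits a horizontal half-line within
  distance 2 d of each of the points, and the distortion of maps into a slit plane makes the u_j
  hyperbolically separated. A Stolz angle has room for only O(log n) such points, a contradiction
  for large n. The bound in the other direction follows by complex conjugation.
*)

theory Submission
  imports Defs "HOL-Real_Asymp.Real_Asymp"
begin

section \<open>Growth and distortion in the disc\<close>

text \<open>The growth estimate is what survives squaring in \<open>slit_plane_distortion\<close>;
  the two estimates together give a two-sided Harnack inequality whose constants do not depend on
  \<open>F\<close>.\<close>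

lemma Schwarz_half_plane:
  assumes holF: "F holomorphic_on ball 0 1"
    and pos: "\<And>z. z \<in> ball 0 1 \<Longrightarrow> Re (F z) > 0"
    and z: "norm z < 1"
  shows "norm (F z - F 0) * (1 - norm z) \<le> 2 * norm z * Re (F 0)"
    and "(1 - norm z) * Re (F 0) \<le> (1 + norm z) * Re (F z)"
proof -
  define A where "A = F 0"
  \<comment> \<open>The Cayley transform sending \<open>A\<close> to \<open>0\<close> reduces the claim to the Schwarz lemma.\<close>
  define W where "W = (\<lambda>z. (F z - A) / (F z + cnj A))"
  have A: "Re A > 0"
    using pos[of 0] by (simp add: A_def)
  have nz: "F z + cnj A \<noteq> 0" if "norm z < 1" for z
  proof -
    have "Re (F z + cnj A) > 0"
      using pos[of z] A that by simp
    then show ?thesis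
      by (metis less_irrefl zero_complex.sel(1))
  qed
  \<comment> \<open>Used twice: positivity of the right side gives \<open>norm (W x) < 1\<close>,
    and at the end the identity recovers \<open>Re (F z)\<close> from \<open>w\<close> and
    \<open>d\<close>.\<close>
  have id: "(norm (F z + cnj A))\<^sup>2 - (norm (F z - A))\<^sup>2 = 4 * Re (F z) * Re A" for z
    unfolding cmod_power2 by (simp add: power2_eq_square algebra_simps)
  have "norm (W z) \<le> norm z"
  proof (rule Schwarz_Lemma(1)[OF _ _ _ z])
    show "W holomorphic_on ball 0 1"
      unfolding W_def using nz by (intro holomorphic_intros holF) auto
    show "W 0 = 0"
      by (simp add: W_def A_def)
    show "norm (W x) < 1" if "norm x < 1" for x
    proof -
      have "(norm (F x - A))\<^sup>2 < (norm (F x + cnj A))\<^sup>2"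
        using id[of x] mult_pos_pos[OF pos[of x] A] that by simp
      then have "norm (F x - A) < norm (F x + cnj A)"
        by (rule power2_less_imp_less) simp
      then show ?thesis
        using nz[OF that] by (simp add: W_def norm_divide)
    qed
  qed
  moreover define w d where "w = norm (W z)" and "d = norm (F z + cnj A)"
  ultimately have w: "0 \<le> w" "w \<le> norm z"
    by auto
  have d: "d > 0"
    using nz[OF z] by (simp add: d_def)
  have FA: "norm (F z - A) = w * d"
    using d by (simp add: w_def d_def W_def norm_divide)
  have sum: "F z + cnj A = (F z - A) + of_real (2 * Re A)"
    by (simp add: complex_eq_iff)
  \<comment> \<open>Since \<open>norm (F z - A) = w * d\<close>, the triangle inequality bounds
    \<open>d\<close> on both sides: \<open>up\<close> leads to the growth estimate,
    \<open>lo\<close> combined with \<open>id\<close> to the second one.\<close>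
  have up: "d \<le> w * d + 2 * Re A"
    using norm_triangle_ineq[of "F z - A" "of_real (2 * Re A)"] A FA
    by (simp add: d_def sum)
  have lo: "2 * Re A \<le> d + w * d"
  proof -
    have "2 * Re A = norm ((F z + cnj A) - (F z - A))"
      using A by (simp add: sum)
    then show ?thesis
      using norm_triangle_ineq4[of "F z + cnj A" "F z - A"] FA by (simp add: d_def)
  qed
  have "w * d * (1 - norm z) \<le> w * d * (1 - w)"
    using w d by (intro mult_left_mono) auto
  also have "\<dots> \<le> w * (2 * Re A)"
    using mult_left_mono[OF up w(1)] by (simp add: algebra_simps)
  also have "\<dots> \<le> norm z * (2 * Re A)"
    using w A by (intro mult_right_mono) auto
  finally show "norm (F z - F 0) * (1 - norm z) \<le> 2 * norm z * Re (F 0)"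
    using FA by (simp add: A_def mult_ac)
  have "4 * Re (F z) * Re A = d\<^sup>2 * (1 - w\<^sup>2)"
    using id[of z] FA by (simp add: d_def power2_eq_square algebra_simps)
  then have e: "4 * Re (F z) * Re A * (1 + w) = (1 - w) * (d + w * d)\<^sup>2"
    by (simp only:) (simp add: power2_eq_square algebra_simps)
  have "(1 - w) * (2 * Re A)\<^sup>2 \<le> (1 - w) * (d + w * d)\<^sup>2"
    using lo A w z by (intro mult_left_mono power_mono) auto
  then have "4 * Re A * ((1 - w) * Re A) \<le> 4 * Re A * (Re (F z) * (1 + w))"
    unfolding e[symmetric] by (simp add: power2_eq_square algebra_simps)
  then have *: "(1 - w) * Re A \<le> Re (F z) * (1 + w)"
    using A by simp
  have "(1 - norm z) * Re A \<le> (1 - w) * Re A"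
    using w A by (intro mult_right_mono) auto
  also note *
  also have "Re (F z) * (1 + w) \<le> Re (F z) * (1 + norm z)"
    using w pos[of z] z by (intro mult_left_mono) auto
  finally show "(1 - norm z) * Re (F 0) \<le> (1 + norm z) * Re (F z)"
    by (simp add: A_def mult_ac)
qed

text \<open>Although \<open>1 - norm f\<close> need not be harmonic, it is the minimum of the
  positive harmonic functions \<open>1 - Re (k * f)\<close> over unimodular \<open>k\<close>, and a
  Harnack bound uniform in \<open>k\<close> passes to the minimum.\<close>

lemma Harnack_one_minus_norm:
  fixes f :: "complex \<Rightarrow> complex"
  assumes holf: "f holomorphic_on ball c \<rho>" and img: "f ` ball c \<rho> \<subseteq> ball 0 1"
    and z: "z \<in> ball c \<rho>"
  shows "(\<rho> - dist c z) * (1 - norm (f c)) \<le> 2 * \<rho> * (1 - norm (f z))"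
    and "(\<rho> - dist c z) * (1 - norm (f z)) \<le> 2 * \<rho> * (1 - norm (f c))"
proof -
  have \<rho>: "\<rho> > 0"
    using z by (metis ball_eq_empty empty_iff not_less)
  define a where "a = (z - c) / of_real \<rho>"
  have na: "norm a = dist c z / \<rho>" and za: "c + of_real \<rho> * a = z"
    using \<rho> by (auto simp: a_def norm_divide dist_norm norm_minus_commute)
  have na1: "norm a < 1"
    using z \<rho> by (simp add: na)
  have inb: "c + of_real \<rho> * x \<in> ball c \<rho>" if "norm x < 1" for x
    using that \<rho> by (simp add: dist_norm norm_mult)
  have *: "(\<rho> - dist c z) * (1 - Re (k * f c)) \<le> 2 * \<rho> * (1 - Re (k * f z)) \<and>
           (\<rho> - dist c z) * (1 - Re (k * f z)) \<le> 2 * \<rho> * (1 - Re (k * f c))"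
    if k: "norm k = 1" for k :: complex
  proof -
    define F where "F = (\<lambda>x. 1 - k * f (c + of_real \<rho> * x))"
    have "f \<circ> (\<lambda>x. c + of_real \<rho> * x) holomorphic_on ball 0 1"
      by (rule holomorphic_on_compose_gen[OF _ holf]) (use inb in \<open>auto intro!: holomorphic_intros\<close>)
    then have holF: "F holomorphic_on ball 0 1"
      unfolding F_def o_def by (intro holomorphic_intros)
    have posF: "Re (F x) > 0" if "x \<in> ball 0 1" for x
    proof -
      have "norm (k * f (c + of_real \<rho> * x)) < 1"
        using img inb[of x] that k by (force simp: norm_mult)
      then show ?thesis
        using complex_Re_le_cmod[of "k * f (c + of_real \<rho> * x)"] by (simp add: F_def)
    qed
    have F0: "Re (F 0) = 1 - Re (k * f c)" and Fa: "Re (F a) = 1 - Re (k * f z)"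
      by (simp_all add: F_def za)
    have pa: "Re (F a) > 0" and p0: "Re (F 0) > 0"
      using posF na1 by auto
    have "(1 - norm a) * Re (F 0) \<le> (1 + norm a) * Re (F a)"
      by (rule Schwarz_half_plane(2)[OF holF posF na1])
    also have "\<dots> \<le> 2 * Re (F a)"
      using na1 pa by (intro mult_right_mono) auto
    finally have 1: "(1 - norm a) * Re (F 0) \<le> 2 * Re (F a)" .
    have "(Re (F a) - Re (F 0)) * (1 - norm a) \<le> norm (F a - F 0) * (1 - norm a)"
      using na1 complex_Re_le_cmod[of "F a - F 0"] by (intro mult_right_mono) auto
    also have "\<dots> \<le> 2 * norm a * Re (F 0)"
      by (rule Schwarz_half_plane(1)[OF holF posF na1])
    finally have "(1 - norm a) * Re (F a) \<le> (1 + norm a) * Re (F 0)"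
      by (simp add: algebra_simps)
    also have "\<dots> \<le> 2 * Re (F 0)"
      using na1 p0 by (intro mult_right_mono) auto
    finally have 2: "(1 - norm a) * Re (F a) \<le> 2 * Re (F 0)" .
    have r: "\<rho> - dist c z = \<rho> * (1 - norm a)"
      using \<rho> by (simp add: na field_simps)
    show ?thesis
      unfolding r F0[symmetric] Fa[symmetric]
      using mult_left_mono[OF 1, of \<rho>] mult_left_mono[OF 2, of \<rho>] \<rho> by (simp add: mult_ac)
  qed
  \<comment> \<open>Rotating so that \<open>k * f z\<close> (or \<open>k * f c\<close>) is its own modulus turns the
    half-plane estimate for \<open>1 - k * f\<close> into one for \<open>1 - norm f\<close>.\<close>
  have rot: "\<exists>k. norm k = 1 \<and> k * w = of_real (norm w)" for w :: complex
  proof (cases "w = 0")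
    case True
    then show ?thesis by (intro exI[of _ 1]) auto
  next
    case False
    then show ?thesis
      by (intro exI[of _ "of_real (norm w) / w"]) (auto simp: norm_divide)
  qed
  have le: "1 - norm w \<le> 1 - Re (k * w)" if "norm k = 1" for k w :: complex
    using complex_Re_le_cmod[of "k * w"] that by (simp add: norm_mult)
  have depth: "0 \<le> \<rho> - dist c z"
    using z by simp
  obtain k where k: "norm k = 1" "k * f z = of_real (norm (f z))"
    using rot by blast
  have "(\<rho> - dist c z) * (1 - norm (f c)) \<le> (\<rho> - dist c z) * (1 - Re (k * f c))"
    using le[OF k(1)] depth by (intro mult_left_mono) auto
  also have "\<dots> \<le> 2 * \<rho> * (1 - norm (f z))"
    using *[OF k(1)] k(2) by simp
  finally show "(\<rho> - dist c z) * (1 - norm (f c)) \<le> 2 * \<rho> * (1 - norm (f z))" .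
  obtain k where k: "norm k = 1" "k * f c = of_real (norm (f c))"
    using rot by blast
  have "(\<rho> - dist c z) * (1 - norm (f z)) \<le> (\<rho> - dist c z) * (1 - Re (k * f z))"
    using le[OF k(1)] depth by (intro mult_left_mono) auto
  also have "\<dots> \<le> 2 * \<rho> * (1 - norm (f c))"
    using *[OF k(1)] k(2) by simp
  finally show "(\<rho> - dist c z) * (1 - norm (f z)) \<le> 2 * \<rho> * (1 - norm (f c))" .
qed

text \<open>A square root opens the plane slit along the half-line left of \<open>w\<close> to a
  half-plane, where the growth estimate applies. Squaring back expresses the result through
  \<open>dist (f u) w\<close>, the squared modulus of the root at \<open>u\<close>.\<close>

lemma slit_plane_distortion:
  assumes holf: "f holomorphic_on ball u r" and r: "r > 0"
    and slit: "\<And>z. z \<in> ball u r \<Longrightarrow> f z - w \<notin> \<real>\<^sub>\<le>\<^sub>0"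
    and z: "dist u z \<le> r / 16"
  shows "dist (f u) (f z) \<le> dist (f u) w / 2"
proof -
  define F where "F = (\<lambda>x. csqrt (f (u + of_real r * x) - w))"
  have inb: "u + of_real r * x \<in> ball u r" if "norm x < 1" for x
    using that r by (simp add: dist_norm norm_mult)
  have "f \<circ> (\<lambda>x. u + of_real r * x) holomorphic_on ball 0 1"
    by (rule holomorphic_on_compose_gen[OF _ holf]) (use inb in \<open>auto intro!: holomorphic_intros\<close>)
  then have holF: "F holomorphic_on ball 0 1"
    unfolding F_def o_def using slit inb by (intro holomorphic_intros) auto
  have posF: "Re (F x) > 0" if "x \<in> ball 0 1" for x
  proof -
    define v where "v = f (u + of_real r * x) - w"
    \<comment> \<open>The principal root has nonnegative real part, so only the imaginary axis,
      which corresponds to the slit, has to be excluded.\<close>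
    have "Re (csqrt v) \<noteq> 0"
    proof
      assume "Re (csqrt v) = 0"
      moreover have "v = (csqrt v)\<^sup>2"
        by simp
      ultimately have "Re v \<le> 0" "Im v = 0"
        by (metis Re_power2 Im_power2 zero_power2 diff_0 neg_le_0_iff_le zero_le_power2 zero_neq_numeral,
            metis Im_power2 mult_zero_right mult_zero_left)
      then show False
        using slit[OF inb[of x]] that by (simp add: v_def complex_nonpos_Reals_iff)
    qed
    then show ?thesis
      using Re_csqrt[of v] by (simp add: F_def v_def)
  qed
  define a where "a = (z - u) / of_real r"
  have na: "norm a \<le> 1 / 16" and za: "u + of_real r * a = z"
    using r z by (auto simp: a_def norm_divide dist_norm norm_minus_commute field_simps)
  define m where "m = norm (F 0)"
  have m: "0 \<le> m" "Re (F 0) \<le> m"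
    by (auto simp: m_def complex_Re_le_cmod)
  have sq: "(F a)\<^sup>2 = f z - w" "(F 0)\<^sup>2 = f u - w"
    by (simp_all add: F_def za)
  define e where "e = norm (F a - F 0)"
  have "e * (15 / 16) \<le> e * (1 - norm a)"
    using na by (intro mult_left_mono) (auto simp: e_def)
  also have "\<dots> \<le> 2 * norm a * Re (F 0)"
    unfolding e_def by (rule Schwarz_half_plane(1)[OF holF posF]) (use na in auto)
  also have "\<dots> \<le> 2 * (1 / 16) * m"
    using na m posF[of 0] by (intro mult_mono) auto
  finally have e: "e \<le> 2 / 15 * m"
    by simp
  have "dist (f u) (f z) = norm ((F a)\<^sup>2 - (F 0)\<^sup>2)"
    by (simp add: sq dist_norm norm_minus_commute)
  also have "\<dots> = norm (F a - F 0) * norm ((F a - F 0) + 2 * F 0)"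
    by (simp add: power2_eq_square algebra_simps flip: norm_mult)
  also have "\<dots> \<le> e * (e + 2 * m)"
    using norm_triangle_ineq[of "F a - F 0" "2 * F 0"]
    by (intro mult_mono) (auto simp: e_def m_def)
  also have "\<dots> \<le> (2 / 15 * m) * (2 / 15 * m + 2 * m)"
    using e m(1) by (intro mult_mono add_mono) (auto simp: e_def)
  also have "\<dots> \<le> m\<^sup>2 / 2"
    using m(1) by (simp add: power2_eq_square field_simps)
  also have "\<dots> = dist (f u) w / 2"
    unfolding m_def dist_norm sq(2)[symmetric] by (simp add: norm_power)
  finally show ?thesis .
qed

section \<open>Two counting arguments\<close>

text \<open>This finds a stretch of length \<open>K * a s\<close> on which \<open>a\<close> loses at
  most half. The middle condition bounds the delay \<open>s - t\<close> by
  \<open>2 * K * a t\<close>.\<close>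

lemma nonincreasing_slow_decay:
  fixes a :: "real \<Rightarrow> real"
  assumes K: "K > 0" and pos: "\<And>x. t \<le> x \<Longrightarrow> a x > 0"
    and mono: "\<And>x y. t \<le> x \<Longrightarrow> x \<le> y \<Longrightarrow> a y \<le> a x"
  obtains s where "t \<le> s" "s + 2 * K * a s \<le> t + 2 * K * a t" "a s \<le> 2 * a (s + K * a s)"
proof -
  define T where "T = t + 2 * K * a t"
  have T: "t \<le> T"
    using K pos[of t] by (simp add: T_def)
  \<comment> \<open>If halving occurred after every such step, the steps would shrink geometrically and
    never leave \<open>{t..T}\<close>, where \<open>a\<close> is bounded below by \<open>a T\<close>.\<close>
  have step: "\<exists>s\<ge>t. s + 2 * K * a s \<le> T \<and> a s \<le> 2 * a (s + K * a s)"
    if "x \<ge> t" "x + 2 * K * a x \<le> T" "a x < 2 ^ n * a T" for x n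
    using that
  proof (induction n arbitrary: x)
    case 0
    \<comment> \<open>No halving is left: \<open>a x < a T\<close> contradicts monotonicity as soon
      as \<open>x \<le> T\<close>.\<close>
    have "x \<le> T"
      using 0 mult_pos_pos[OF K pos[OF 0(1)]] by linarith
    then show ?case
      using mono[of x T] 0 by auto
  next
    case (Suc n)
    define y where "y = x + K * a x"
    show ?case
    proof (cases "a x \<le> 2 * a y")
      case True
      then show ?thesis
        using Suc.prems by (auto simp: y_def)
    next
      case False
      show ?thesis
      proof (rule Suc.IH)
        show "t \<le> y"
          using Suc.prems(1) mult_pos_pos[OF K pos[OF Suc.prems(1)]] by (simp add: y_def)
        \<comment> \<open>More than halving \<open>a\<close> releases at least the amount
          \<open>K * a x\<close> by which the time has advanced, so \<open>x + 2 * K * a x\<close>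
          does not grow.\<close>
        have "K * (2 * a y) \<le> K * a x"
          using False K by (intro mult_left_mono) auto
        then show "y + 2 * K * a y \<le> T"
          using Suc.prems(2) by (simp add: y_def)
        show "a y < 2 ^ n * a T"
          using False Suc.prems(3) by simp
      qed
    qed
  qed
  obtain n where "a t / a T < 2 ^ n"
    using real_arch_pow[of 2 "a t / a T"] by auto
  then have "a t < 2 ^ n * a T"
    using pos[OF T] by (simp add: field_simps)
  then show ?thesis
    using step[of t n] that by (auto simp: T_def)
qed

text \<open>On one dyadic scale of \<open>r\<close> the points lie within a multiple of that scale
  from \<sigma> and are separated by a multiple of it, so their number is bounded. The number of
  scales is logarithmic in \<open>hi / lo\<close>.\<close>

lemma Stolz_packing:
  fixes U :: "complex set" and r :: "complex \<Rightarrow> real"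
  assumes ne: "U \<noteq> {}" and lo: "0 < lo" and s: "0 < s" and M: "0 \<le> M"
    and range: "\<And>u. u \<in> U \<Longrightarrow> lo \<le> r u \<and> r u \<le> hi"
    and stolz: "\<And>u. u \<in> U \<Longrightarrow> dist \<sigma> u \<le> M * r u"
    and sep: "\<And>u v. u \<in> U \<Longrightarrow> v \<in> U \<Longrightarrow> u \<noteq> v \<Longrightarrow> s * r u \<le> dist u v"
  shows "real (card U) \<le> (log 2 (hi / lo) + 2) * (8 * M / s + 3)\<^sup>2"
proof -
  \<comment> \<open>Two points of \<open>U\<close> in the same dyadic range of \<open>r\<close> cannot share a cell of a square grid
    of mesh comparable to \<open>s * r\<close>.\<close>
  define q where "q = s / 2"
  define m where "m = (\<lambda>u. \<lfloor>log 2 (r u)\<rfloor>)"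
  define cell where "cell = (\<lambda>u x. \<lfloor>x / (q * 2 powr of_int (m u))\<rfloor>)"
  define F where "F = (\<lambda>u. (m u, cell u (Re (u - \<sigma>)), cell u (Im (u - \<sigma>))))"
  \<comment> \<open>In units of the mesh, coordinates are at most \<open>2 * M / q\<close>; the
    extra 1 covers the rounding down of negative ones.\<close>
  define B where "B = \<lfloor>2 * M / q\<rfloor> + 1"
  have lohi: "lo \<le> hi"
    using ne range by force
  have rpos: "0 < r u" if "u \<in> U" for u
    using range[OF that] lo by auto
  have m1: "2 powr of_int (m u) \<le> r u" and m2: "r u < 2 * 2 powr of_int (m u)" if "u \<in> U" for u
  proof -
    have "2 powr of_int (m u) \<le> 2 powr (log 2 (r u))"
      by (simp add: m_def)
    then show "2 powr of_int (m u) \<le> r u"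
      using rpos[OF that] by simp
    have "2 powr (log 2 (r u)) < 2 powr (1 + of_int (m u))"
      unfolding m_def by (intro powr_less_mono) linarith+
    then show "r u < 2 * 2 powr of_int (m u)"
      using rpos[OF that] by (simp add: powr_add)
  qed
  have "inj_on F U"
  proof (rule inj_onI, rule ccontr)
    fix u v assume uv: "u \<in> U" "v \<in> U" "F u = F v" "u \<noteq> v"
    define g where "g = q * 2 powr of_int (m u)"
    have g: "g > 0"
      using s by (simp add: g_def q_def)
    have fl: "\<bar>x - y\<bar> < g" if "\<lfloor>x / g\<rfloor> = \<lfloor>y / g\<rfloor>" for x y
    proof -
      have "\<bar>x / g - y / g\<bar> < 1"
        using that by linarith
      then show ?thesis
        using g by (simp add: field_simps flip: diff_divide_distrib)
    qed
    have "\<bar>Re (u - \<sigma>) - Re (v - \<sigma>)\<bar> < g" "\<bar>Im (u - \<sigma>) - Im (v - \<sigma>)\<bar> < g"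
      using uv(3) by (intro fl; simp add: F_def cell_def g_def del: minus_complex.sel)+
    \<comment> \<open>The distance is bounded by the sum of two coordinate differences, hence the
      choice of half of \<open>s\<close> for \<open>q\<close>.\<close>
    then have "dist u v < 2 * g"
      using cmod_le[of "u - v"] by (simp add: dist_norm)
    also have "\<dots> \<le> s * r u"
      using m1[OF uv(1)] s by (simp add: g_def q_def)
    finally show False
      using sep[OF uv(1,2,4)] by simp
  qed
  moreover have "F ` U \<subseteq> {\<lfloor>log 2 lo\<rfloor>..\<lfloor>log 2 hi\<rfloor>} \<times> {-B..B} \<times> {-B..B}"
  proof
    fix y assume "y \<in> F ` U"
    then obtain u where u: "u \<in> U" "y = F u"
      by auto
    have "log 2 lo \<le> log 2 (r u)" "log 2 (r u) \<le> log 2 hi"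
      using range[OF u(1)] lo by auto
    then have 1: "m u \<in> {\<lfloor>log 2 lo\<rfloor>..\<lfloor>log 2 hi\<rfloor>}"
      unfolding m_def by (auto intro: floor_mono)
    have c: "cell u x \<in> {-B..B}" if "\<bar>x\<bar> \<le> dist \<sigma> u" for x
    proof -
      define g where "g = q * 2 powr of_int (m u)"
      have g: "g > 0"
        using s by (simp add: g_def q_def)
      have "\<bar>x\<bar> \<le> M * r u"
        using that stolz[OF u(1)] by simp
      also have "\<dots> \<le> M * (2 * 2 powr of_int (m u))"
        using m2[OF u(1)] M by (intro mult_left_mono) auto
      also have "\<dots> = (2 * M / q) * g"
        using s by (simp add: g_def q_def)
      finally have "\<bar>x / g\<bar> \<le> 2 * M / q"
        using g by (simp add: abs_divide pos_divide_le_eq)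
      then have "-B \<le> cell u x" "cell u x \<le> B"
        unfolding cell_def g_def[symmetric] B_def by linarith+
      then show ?thesis
        by simp
    qed
    have "\<bar>Re (u - \<sigma>)\<bar> \<le> dist \<sigma> u" "\<bar>Im (u - \<sigma>)\<bar> \<le> dist \<sigma> u"
      by (metis abs_Re_le_cmod abs_Im_le_cmod dist_norm norm_minus_commute)+
    then show "y \<in> {\<lfloor>log 2 lo\<rfloor>..\<lfloor>log 2 hi\<rfloor>} \<times> {-B..B} \<times> {-B..B}"
      unfolding u(2) F_def using 1 c by blast
  qed
  ultimately have "card U \<le> card ({\<lfloor>log 2 lo\<rfloor>..\<lfloor>log 2 hi\<rfloor>} \<times> {-B..B} \<times> {-B..B})"
    by (intro card_inj_on_le) auto
  then have "real (card U) \<le> real (card {\<lfloor>log 2 lo\<rfloor>..\<lfloor>log 2 hi\<rfloor>} * (card {-B..B} * card {-B..B}))"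
    by (simp only: card_cartesian_product of_nat_le_iff)
  also have "\<dots> = real (card {\<lfloor>log 2 lo\<rfloor>..\<lfloor>log 2 hi\<rfloor>}) * (real (card {-B..B}))\<^sup>2"
    by (simp add: power2_eq_square)
  also have "\<dots> \<le> (log 2 (hi / lo) + 2) * (8 * M / s + 3)\<^sup>2"
  proof (intro mult_mono power_mono)
    have "\<lfloor>log 2 lo\<rfloor> \<le> \<lfloor>log 2 hi\<rfloor>"
      using lohi lo by (intro floor_mono) auto
    moreover have "log 2 (hi / lo) = log 2 hi - log 2 lo"
      using lo lohi by (simp add: log_divide)
    ultimately show "real (card {\<lfloor>log 2 lo\<rfloor>..\<lfloor>log 2 hi\<rfloor>}) \<le> log 2 (hi / lo) + 2"
      by simp linarith
    show "0 \<le> log 2 (hi / lo) + 2"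
      using lo lohi by (smt (verit) divide_le_eq_1_pos le_divide_eq_1_pos zero_le_log_cancel_iff)
    have "0 \<le> 2 * M / q"
      using M s by (simp add: q_def)
    then have "0 \<le> B" 
      by (simp add: B_def)
    then have "real (card {-B..B}) = 2 * of_int B + 1"
      by simp
    also have "\<dots> \<le> 2 * (2 * M / q + 1) + 1"
      unfolding B_def of_int_add of_int_1
      by (intro add_right_mono mult_left_mono of_int_floor_le) simp
    finally show "real (card {-B..B}) \<le> 8 * M / s + 3"
      by (simp add: q_def)
  qed auto
  finally show ?thesis .
qed

lemma infdist_lessE:
  assumes "infdist x A < e" "A \<noteq> {}"
  obtains a where "a \<in> A" "dist x a < e"
  using cInf_lessD[of "dist x ` A" e] assms by (auto simp: infdist_notempty)

section \<open>Backward orbits in a Stolz angle\<close>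

text \<open>Only the geometry of the orbit is kept: a domain stable under translation to the right
  and a leftward ray whose preimage ends in a Stolz angle. These assumptions are invariant under
  conjugation, so one inequality yields the other.\<close>

locale horizontal_orbit =
  fixes h :: "complex \<Rightarrow> complex" and u :: "real \<Rightarrow> complex" and p \<sigma> :: complex and M T :: real
  assumes holh: "h holomorphic_on ball 0 1" and injh: "inj_on h (ball 0 1)"
    and translate: "\<And>w s. w \<in> h ` ball 0 1 \<Longrightarrow> 0 \<le> s \<Longrightarrow> w + of_real s \<in> h ` ball 0 1"
    and u_disc: "\<And>t. 0 \<le> t \<Longrightarrow> u t \<in> ball 0 1"
    and h_u: "\<And>t. 0 \<le> t \<Longrightarrow> h (u t) = p - of_real t"
    and M: "0 \<le> M" and T: "0 \<le> T"
    and stolz: "\<And>t. T \<le> t \<Longrightarrow> dist \<sigma> (u t) \<le> M * (1 - norm (u t))"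
begin

text \<open>The whole complement is taken instead of the boundary because it is stable under
  translation to the left, which makes \<open>gap\<close> nonincreasing.\<close>

definition above :: "complex set"
  where "above = {w. w \<notin> h ` ball 0 1 \<and> Im w > Im p}"

definition below :: "complex set"
  where "below = {w. w \<notin> h ` ball 0 1 \<and> Im w < Im p}"

definition gap :: "real \<Rightarrow> real"
  where "gap t = infdist (p - of_real t) above"

lemma orbit_in_image: "0 \<le> t \<Longrightarrow> p - of_real t \<in> h ` ball 0 1"
  using u_disc h_u by (metis imageI)

lemma gap_pos:
  assumes "above \<noteq> {}" "0 \<le> t"
  shows "gap t > 0"
proof -
  have "open (h ` ball 0 1)"
    by (rule open_mapping_thm3[OF holh _ injh]) simp
  then obtain e where e: "e > 0" "ball (p - of_real t) e \<subseteq> h ` ball 0 1"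
    using orbit_in_image[OF assms(2)] by (meson openE)
  have "\<not> gap t < e"
    unfolding gap_def using infdist_lessE[OF _ assms(1)] e(2)
    by (metis (no_types, lifting) above_def mem_Collect_eq mem_ball subsetD)
  then show ?thesis
    using e by simp
qed

lemma gap_antimono:
  assumes "above \<noteq> {}" "x \<le> y"
  shows "gap y \<le> gap x"
proof (rule ccontr)
  assume "\<not> gap y \<le> gap x"
  then obtain w where w: "w \<in> above" "dist (p - of_real x) w < gap y"
    using infdist_lessE[OF _ assms(1)] by (metis gap_def not_le)
  have "w - of_real (y - x) \<in> above"
    using w(1) translate[of "w - of_real (y - x)" "y - x"] assms(2) by (auto simp: above_def)
  then have "gap y \<le> dist (p - of_real y) (w - of_real (y - x))"
    unfolding gap_def by (rule infdist_le)
  also have "\<dots> = dist (p - of_real x) w"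
    by (simp add: dist_norm algebra_simps)
  finally show False
    using w(2) by simp
qed

text \<open>The left side counts orbit points, the right side is the packing bound for them: depths
  within a ratio \<open>2 ^ 14 * n ^ 4\<close> and relative separation 1/16. It fails for large
  \<open>n\<close>, which refutes \<open>far\<close>.\<close>

lemma slow_stretch_count:
  assumes ne: "above \<noteq> {}" and n: "1 \<le> n" and s: "T \<le> s"
    and slow: "gap s \<le> 2 * gap (s + 4 * real n * gap s)"
    and far: "\<And>w. w \<in> below \<Longrightarrow> (16 * (real n)\<^sup>2 + 4 * real n) * gap s < dist (p - of_real s) w"
  shows "real n + 1 \<le> (16 + 4 * log 2 (real n)) * (128 * M + 3)\<^sup>2"
proof -
  define N where "N = real n"
  define \<delta> where "\<delta> = gap s"
  \<comment> \<open>The cap of the disc \<open>B\<close> above the line has height \<open>\<delta> / 4\<close>, and with this radius its chord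
    on the line has length at most \<open>4 * N * \<delta>\<close>.\<close>
  define \<rho> where "\<rho> = 8 * N\<^sup>2 * \<delta>"
  define q where "q = Complex (Re p - s - 2 * N * \<delta>) (Im p - \<rho> + \<delta> / 4)"
  \<comment> \<open>The points start at the middle of the stretch and occupy its third quarter,
    which keeps them away from the circle bounding \<open>B\<close>.\<close>
  define \<tau> where "\<tau> = (\<lambda>j::nat. s + 2 * N * \<delta> + real j * \<delta>)"
  define B where "B = ball q \<rho>"
  have s0: "0 \<le> s"
    using s T by simp
  have N: "N \<ge> 1" and N2: "N\<^sup>2 \<ge> 1"
    using n by (auto simp: N_def)
  have \<delta>: "\<delta> > 0"
    unfolding \<delta>_def by (rule gap_pos[OF ne s0])
  have \<rho>: "\<rho> \<ge> 8 * \<delta>"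
    using N2 \<delta> by (simp add: \<rho>_def)
  have near: "s \<le> Re p - Re w \<and> Re p - Re w \<le> s + 4 * N * \<delta> \<and> Im w < Im p + \<delta> / 4"
    if "w \<in> B" "Im p \<le> Im w" for w
  proof -
    define e v where "e = Re w - Re q" and "v = Im w - Im p"
    have v: "0 \<le> v"
      using that by (simp add: v_def)
    have "(dist q w)\<^sup>2 < \<rho>\<^sup>2"
      using that \<rho> \<delta> by (intro power_strict_mono) (auto simp: B_def)
    moreover have "(dist q w)\<^sup>2 = e\<^sup>2 + (v + (\<rho> - \<delta> / 4))\<^sup>2"
      by (simp add: dist_norm cmod_power2 e_def v_def q_def power2_commute algebra_simps)
    ultimately have *: "e\<^sup>2 + (v + (\<rho> - \<delta> / 4))\<^sup>2 < \<rho>\<^sup>2"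
      by simp
    then have "(v + (\<rho> - \<delta> / 4))\<^sup>2 < \<rho>\<^sup>2"
      using zero_le_power2[of e] by linarith
    then have 1: "v + (\<rho> - \<delta> / 4) < \<rho>"
      by (rule power2_less_imp_less) (use \<rho> \<delta> in auto)
    have "(\<rho> - \<delta> / 4)\<^sup>2 \<le> (v + (\<rho> - \<delta> / 4))\<^sup>2"
      using v \<rho> \<delta> by (intro power_mono) auto
    then have "e\<^sup>2 < \<rho>\<^sup>2 - (\<rho> - \<delta> / 4)\<^sup>2"
      using * by linarith
    also have "\<dots> \<le> \<rho> * \<delta> / 2"
      by (simp add: power2_eq_square algebra_simps)
    also have "\<dots> = (2 * N * \<delta>)\<^sup>2"
      by (simp add: \<rho>_def power2_eq_square)
    finally have "\<bar>e\<bar> < 2 * N * \<delta>"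
      using N \<delta> by (intro power2_less_imp_less[of "\<bar>e\<bar>"]) auto
    then show ?thesis
      using 1 by (auto simp: e_def v_def q_def)
  qed
  \<comment> \<open>Points on the line belong to the orbit. Points above it are closer than
    \<delta>/4 to an orbit point whose \<open>gap\<close> is at least \<delta>/2. Points below it
    are too near \<open>p - s\<close> to violate \<open>far\<close>.\<close>
  have B: "B \<subseteq> h ` ball 0 1"
  proof
    fix w assume w: "w \<in> B"
    show "w \<in> h ` ball 0 1"
    proof (cases "Im p \<le> Im w")
      case True
      define t where "t = Re p - Re w"
      have t: "s \<le> t" "t \<le> s + 4 * N * \<delta>" and im: "Im w < Im p + \<delta> / 4"
        using near[OF w True] by (auto simp: t_def)
      have wt: "w = p - of_real t + \<i> * of_real (Im w - Im p)"
        by (simp add: complex_eq_iff t_def)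
      show ?thesis
      proof (cases "Im w = Im p")
        case True
        then show ?thesis
          using orbit_in_image[of t] t s0 wt by simp
      next
        case False
        have "\<delta> / 2 \<le> gap t"
          using gap_antimono[OF ne t(2)] slow by (simp add: \<delta>_def N_def)
        moreover have "dist (p - of_real t) w = Im w - Im p"
          using True by (subst wt) (simp add: dist_norm norm_mult del: of_real_diff)
        ultimately have "w \<notin> above"
          using infdist_le[of w above "p - of_real t"] im \<delta> by (auto simp: gap_def)
        then show ?thesis
          using True False by (auto simp: above_def)
      qed
    next
      case False
      have "norm (p - of_real s - q) \<le> \<bar>2 * N * \<delta>\<bar> + \<bar>\<rho> - \<delta> / 4\<bar>"
        using cmod_le[of "p - of_real s - q"] by (simp add: q_def)
      also have "\<dots> \<le> 2 * N * \<delta> + \<rho>"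
        using \<rho> \<delta> N by simp
      finally have "dist (p - of_real s) w \<le> 2 * N * \<delta> + \<rho> + \<rho>"
        using w dist_triangle[of "p - of_real s" w q] by (simp add: B_def dist_norm)
      also have "\<dots> \<le> (16 * N\<^sup>2 + 4 * N) * \<delta>"
        using N \<delta> by (simp add: \<rho>_def algebra_simps)
      finally have "w \<notin> below"
        using far[of w] by (auto simp: N_def \<delta>_def)
      then show ?thesis
        using False by (auto simp: below_def)
    qed
  qed
  obtain g where g: "g holomorphic_on h ` ball 0 1" "\<And>z. z \<in> ball 0 1 \<Longrightarrow> g (h z) = z"
    by (rule holomorphic_has_inverse[OF holh open_ball injh], rule that)
  have gB: "g holomorphic_on ball q \<rho>" "g ` ball q \<rho> \<subseteq> ball 0 1"
    using B g(2) by (auto simp: B_def intro: holomorphic_on_subset[OF g(1)])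
  have \<tau>: "s \<le> \<tau> j" "0 \<le> \<tau> j" for j
    using s0 N \<delta> by (auto simp: \<tau>_def)
  have gz: "g (p - of_real (\<tau> j)) = u (\<tau> j)" for j
    using h_u[OF \<tau>(2)] g(2)[OF u_disc[OF \<tau>(2)]] by metis
  define R where "R = 1 - norm (g q)"
  have Rpos: "R > 0"
    using gB(2) \<rho> \<delta> by (force simp: R_def)
  \<comment> \<open>The orbit points have depth at least \<delta>/8 in \<open>B\<close>, so the
    Harnack factor is at most \<open>2 * \<rho> / (\<delta> / 8) = 128 * N\<^sup>2\<close>.\<close>
  have R: "R / (128 * N\<^sup>2) \<le> 1 - norm (u (\<tau> j)) \<and> 1 - norm (u (\<tau> j)) \<le> R * (128 * N\<^sup>2)"
    if "j \<le> n" for j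
  proof -
    define z where "z = p - of_real (\<tau> j)"
    define r where "r = 1 - norm (u (\<tau> j))"
    have r: "r > 0"
      using u_disc[OF \<tau>(2)] by (simp add: r_def)
    have "(dist q z)\<^sup>2 = (real j * \<delta>)\<^sup>2 + (\<rho> - \<delta> / 4)\<^sup>2"
      by (simp add: dist_norm cmod_power2 z_def \<tau>_def q_def power2_commute)
    also have "\<dots> \<le> (N * \<delta>)\<^sup>2 + (\<rho> - \<delta> / 4)\<^sup>2"
      using that \<delta> \<rho> by (intro add_mono power_mono mult_right_mono) (auto simp: N_def)
    also have "\<dots> \<le> (\<rho> - \<delta> / 8)\<^sup>2"
    proof -
      have "(\<rho> - \<delta> / 8)\<^sup>2 - (\<rho> - \<delta> / 4)\<^sup>2 - (N * \<delta>)\<^sup>2 = (N\<^sup>2 - 3 / 64) * \<delta>\<^sup>2"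
        by (simp add: \<rho>_def power2_eq_square field_simps)
      also have "\<dots> \<ge> 0"
        using N2 by simp
      finally show ?thesis by linarith
    qed
    finally have "dist q z \<le> \<rho> - \<delta> / 8"
      by (rule power2_le_imp_le) (use \<rho> \<delta> in linarith)
    then have depth: "\<delta> / 8 \<le> \<rho> - dist q z" and zB: "z \<in> ball q \<rho>"
      using \<delta> by auto
    have "(\<rho> - dist q z) * R \<le> 2 * \<rho> * r" "(\<rho> - dist q z) * r \<le> 2 * \<rho> * R"
      using Harnack_one_minus_norm[OF gB zB] gz[of j] by (simp_all add: R_def r_def z_def)
    then have "\<delta> / 8 * R \<le> 2 * \<rho> * r" "\<delta> / 8 * r \<le> 2 * \<rho> * R"
      using mult_right_mono[OF depth, of R] mult_right_mono[OF depth, of r] Rpos r by linarith+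
    then have "R \<le> 128 * N\<^sup>2 * r" "r \<le> R * (128 * N\<^sup>2)"
      using \<delta> by (simp_all add: \<rho>_def field_simps)
    then show ?thesis
      using N by (auto simp: r_def field_simps)
  qed
  have sep: "(1 - norm (u (\<tau> j))) / 16 < dist (u (\<tau> j)) (u (\<tau> k))" if "j \<noteq> k" for j k
  proof (rule ccontr)
    assume "\<not> ?thesis"
    then have close: "dist (u (\<tau> j)) (u (\<tau> k)) \<le> (1 - norm (u (\<tau> j))) / 16"
      by simp
    \<comment> \<open>The factor 2 makes the inequality strict, so some \<open>w\<close> in
      \<open>above\<close> realizes it. The half-line left of \<open>w\<close> is then omitted by
      \<open>h\<close>, and distortion puts the two images closer than \<delta>, although their
      spacing is at least \<delta>.\<close>
    have "gap (\<tau> j) < 2 * \<delta>"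
      using gap_antimono[OF ne \<tau>(1)[of j]] \<delta> by (simp add: \<delta>_def)
    then obtain w where w: "w \<in> above" "dist (p - of_real (\<tau> j)) w < 2 * \<delta>"
      using infdist_lessE[OF _ ne] by (auto simp: gap_def)
    have sub: "ball (u (\<tau> j)) (1 - norm (u (\<tau> j))) \<subseteq> ball 0 1"
      by (simp add: ball_subset_ball_iff)
    have slit: "h z - w \<notin> \<real>\<^sub>\<le>\<^sub>0" if "z \<in> ball 0 1" for z
    proof
      assume "h z - w \<in> \<real>\<^sub>\<le>\<^sub>0"
      then have "w = h z + of_real (- Re (h z - w))" "0 \<le> - Re (h z - w)"
        by (auto simp: complex_nonpos_Reals_iff complex_eq_iff)
      then show False
        using translate[of "h z" "- Re (h z - w)"] that w(1) by (auto simp: above_def)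
    qed
    have "dist (h (u (\<tau> j))) (h (u (\<tau> k))) \<le> dist (h (u (\<tau> j))) w / 2"
    proof (rule slit_plane_distortion[OF _ _ _ close])
      show "h holomorphic_on ball (u (\<tau> j)) (1 - norm (u (\<tau> j)))"
        by (rule holomorphic_on_subset[OF holh sub])
      show "0 < 1 - norm (u (\<tau> j))"
        using u_disc[OF \<tau>(2)] by simp
    qed (use slit sub in blast)
    then have "dist (p - of_real (\<tau> j)) (p - of_real (\<tau> k)) < \<delta>"
      using w(2) by (simp add: h_u[OF \<tau>(2)])
    moreover have "dist (p - of_real (\<tau> j)) (p - of_real (\<tau> k)) = \<bar>real k - real j\<bar> * \<delta>"
    proof -
      have "(p - of_real (\<tau> j)) - (p - of_real (\<tau> k)) = of_real ((real k - real j) * \<delta>)"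
        by (simp add: \<tau>_def algebra_simps)
      then show ?thesis
        using \<delta> by (simp only: dist_norm norm_of_real abs_mult)
    qed
    moreover have "1 \<le> \<bar>real k - real j\<bar>"
      using that by linarith
    ultimately show False
      using \<delta> mult_right_mono[of 1 "\<bar>real k - real j\<bar>" \<delta>] by simp
  qed
  define U where "U = (\<lambda>j. u (\<tau> j)) ` {..n}"
  have "inj_on (\<lambda>j. u (\<tau> j)) {..n}"
  proof (rule inj_onI, rule ccontr)
    fix j k assume "u (\<tau> j) = u (\<tau> k)" "j \<noteq> k"
    then show False
      using sep[of j k] u_disc[OF \<tau>(2), of j] by simp
  qed
  then have "card U = n + 1"
    by (simp add: U_def card_image)
  moreover have "real (card U) \<le>
      (log 2 (R * (128 * N\<^sup>2) / (R / (128 * N\<^sup>2))) + 2) * (8 * M / (1 / 16) + 3)\<^sup>2"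
  proof (rule Stolz_packing[where r = "\<lambda>z. 1 - norm z" and \<sigma> = \<sigma>])
    show "U \<noteq> {}" "0 < R / (128 * N\<^sup>2)"
      using Rpos N by (auto simp: U_def)
    show "R / (128 * N\<^sup>2) \<le> 1 - norm z \<and> 1 - norm z \<le> R * (128 * N\<^sup>2)" if "z \<in> U" for z
      using that R by (auto simp: U_def)
    show "dist \<sigma> z \<le> M * (1 - norm z)" if "z \<in> U" for z
      using that stolz order_trans[OF s \<tau>(1)] by (auto simp: U_def)
    show "1 / 16 * (1 - norm z) \<le> dist z z'" if "z \<in> U" "z' \<in> U" "z \<noteq> z'" for z z'
    proof -
      from that obtain j k where "z = u (\<tau> j)" "z' = u (\<tau> k)" "j \<noteq> k"
        by (auto simp: U_def)
      then show ?thesis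
        using sep[of j k] by simp
    qed
  qed (use M in auto)
  moreover have "log 2 (R * (128 * N\<^sup>2) / (R / (128 * N\<^sup>2))) = 14 + 4 * log 2 N"
  proof -
    have "R * (128 * N\<^sup>2) / (R / (128 * N\<^sup>2)) = 2 ^ 14 * N ^ 4"
      using Rpos N by (simp add: power2_eq_square power4_eq_xxxx)
    moreover have "log 2 (2 ^ 14 * N ^ 4) = log 2 (2 ^ 14) + log 2 (N ^ 4)"
      using N by (subst log_mult) auto
    moreover have "log 2 (2 ^ 14 :: real) = 14 * log 2 2" "log 2 (N ^ 4) = 4 * log 2 N"
      using N log_nat_power[of 2 2 14] log_nat_power[of N 2 4] by (simp_all only: of_nat_numeral)
    ultimately show ?thesis
      by simp
  qed
  ultimately show ?thesis
    by (simp add: N_def)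
qed

text \<open>If every point of \<open>below\<close> were too far at a time \<open>t \<ge> T\<close>,
  the same would hold at a nearby slow time, where the logarithmic packing bound contradicts the
  linear number of points.\<close>

lemma gap_below_le:
  assumes ne: "above \<noteq> {}"
  obtains c where "c \<ge> 1" "\<And>t. 0 \<le> t \<Longrightarrow> \<exists>w\<in>below. dist (p - of_real t) w \<le> c * gap t"
proof -
  define C where "C = (128 * M + 3)\<^sup>2"
  have "((\<lambda>n. (16 + 4 * log 2 (real n)) * C / (real n + 1)) \<longlongrightarrow> 0) at_top"
    by real_asymp
  then have "eventually (\<lambda>n. (16 + 4 * log 2 (real n)) * C / (real n + 1) < 1) at_top"
    by (rule order_tendstoD) simp
  then obtain n where n: "1 \<le> n" "(16 + 4 * log 2 (real n)) * C / (real n + 1) < 1"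
    using eventually_happens[OF eventually_conj[OF _ eventually_ge_at_top[of 1]]] by fastforce
  then have big: "\<not> real n + 1 \<le> (16 + 4 * log 2 (real n)) * C"
    by (simp add: field_simps)
  \<comment> \<open>The hypothesis \<open>far\<close> accounts for
    \<open>16 * n\<^sup>2 + 4 * n\<close>; the remaining \<open>8 * n\<close> pays for the delay
    from \<open>t\<close> to \<open>s\<close>.\<close>
  define c where "c = 16 * (real n)\<^sup>2 + 12 * real n"
  have c: "c \<ge> 1"
    using n(1) by (simp add: c_def add_increasing)
  have late: "\<exists>w\<in>below. dist (p - of_real t) w \<le> c * gap t" if t: "T \<le> t" for t
  proof (rule ccontr)
    assume none: "\<not> ?thesis"
    have t0: "0 \<le> t"
      using t T by simp
    obtain s where s: "t \<le> s" "s + 2 * (4 * real n) * gap s \<le> t + 2 * (4 * real n) * gap t"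
      "gap s \<le> 2 * gap (s + 4 * real n * gap s)"
    proof (rule nonincreasing_slow_decay[of "4 * real n" t gap])
      show "0 < 4 * real n"
        using n(1) by simp
      show "gap x > 0" if "t \<le> x" for x
        using gap_pos[OF ne] t0 that by simp
    qed (use gap_antimono[OF ne] in auto)
    have pos: "0 < gap s" "0 < gap t" and le: "gap s \<le> gap t"
      using gap_pos[OF ne] gap_antimono[OF ne] t0 s(1) by auto
    have "(16 * (real n)\<^sup>2 + 4 * real n) * gap s < dist (p - of_real s) w" if "w \<in> below" for w
    proof -
      have "c * gap t < dist (p - of_real t) w"
        using none that by force
      also have "\<dots> \<le> (s - t) + dist (p - of_real s) w"
        using dist_triangle[of "p - of_real t" w "p - of_real s"] s(1)
        by (simp add: dist_norm flip: of_real_diff)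
      also have "s - t \<le> 8 * real n * gap t"
      proof -
        have "0 \<le> 8 * real n * gap s"
          using pos(1) by simp
        then show ?thesis
          using s(2) by linarith
      qed
      finally have "(16 * (real n)\<^sup>2 + 4 * real n) * gap t < dist (p - of_real s) w"
        by (simp add: c_def algebra_simps)
      moreover have "(16 * (real n)\<^sup>2 + 4 * real n) * gap s \<le> (16 * (real n)\<^sup>2 + 4 * real n) * gap t"
        using le by (intro mult_left_mono) auto
      ultimately show ?thesis
        by simp
    qed
    then show False
      using slow_stretch_count[OF ne n(1) _ s(3)] t s(1) big by (auto simp: C_def)
  qed
  have gT: "gap T > 0"
    by (rule gap_pos[OF ne T])
  \<comment> \<open>Before time \<open>T\<close>, comparison with \<open>T\<close> costs a shift of
    at most \<open>T\<close>, which is at most \<open>(T / gap T) * gap t\<close> by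
    monotonicity.\<close>
  define c' where "c' = c + T / gap T"
  have "\<exists>w\<in>below. dist (p - of_real t) w \<le> c' * gap t" if t: "0 \<le> t" for t
  proof (cases "T \<le> t")
    case True
    have "c * gap t \<le> c' * gap t"
      using gap_pos[OF ne t] gT T by (intro mult_right_mono) (auto simp: c'_def)
    then show ?thesis
      using late[OF True] by (meson order_trans)
  next
    case False
    obtain w where w: "w \<in> below" "dist (p - of_real T) w \<le> c * gap T"
      using late by blast
    have "dist (p - of_real t) w \<le> (T - t) + dist (p - of_real T) w"
      using dist_triangle[of "p - of_real t" w "p - of_real T"] False
      by (simp add: dist_norm flip: of_real_diff)
    also have "\<dots> \<le> c' * gap T"
      using w(2) t gT by (simp add: c'_def distrib_right)
    also have "\<dots> \<le> c' * gap t"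
      using gap_antimono[OF ne, of t T] False c T gT by (intro mult_left_mono) (auto simp: c'_def)
    finally show ?thesis
      using w(1) by blast
  qed
  moreover have "c' \<ge> 1"
    using c T gT by (simp add: c'_def add_increasing2)
  ultimately show ?thesis
    using that by blast
qed

end

section \<open>From the complement of the domain to its boundary\<close>

lemma frontier_on_segment:
  fixes S :: "'a::real_normed_vector set"
  assumes "open S" "z \<in> S" "w \<notin> S"
  obtains v where "0 < v" "v \<le> 1" "z + v *\<^sub>R (w - z) \<in> frontier S"
proof -
  have "closed_segment z w \<inter> frontier S \<noteq> {}"
    by (rule connected_Int_frontier) (use assms in auto)
  then obtain y where y: "y \<in> closed_segment z w" "y \<in> frontier S"
    by blast
  then obtain v where v: "0 \<le> v" "v \<le> 1" "y = z + v *\<^sub>R (w - z)"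
    by (auto simp: closed_segment_def algebra_simps)
  \<comment> \<open>An open set contains none of its frontier points. Positive \<open>v\<close>
    later puts the frontier point strictly below the line.\<close>
  have "v \<noteq> 0"
    using v y(2) assms by (auto simp: frontier_def interior_open)
  then show ?thesis
    using that v y(2) by (metis less_eq_real_def)
qed

context horizontal_orbit
begin

text \<open>Both replacements go the right way: the upper boundary lies in \<open>above\<close>, so
  its distance is at least \<open>gap\<close>, while a segment from the orbit to
  \<open>below\<close> meets the lower boundary no later than at its end.\<close>

lemma delta_minus_le_delta_plus:
  obtains c where "c \<ge> 1"
    "\<And>t. 0 \<le> t \<Longrightarrow> delta_minus (h ` ball 0 1) p (p - of_real t)
        \<le> ereal c * delta_plus (h ` ball 0 1) p (p - of_real t)"
proof (cases "upper_boundary (h ` ball 0 1) p = {}")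
  \<comment> \<open>Here \<open>delta_plus\<close> is infinite at every point, so any positive
    constant works.\<close>
  case True
  then show ?thesis
    by (intro that[of 1]) (auto simp: delta_plus_def ext_dist_def)
next
  case False
  have op: "open (h ` ball 0 1)"
    by (rule open_mapping_thm3[OF holh _ injh]) simp
  then have sub: "upper_boundary (h ` ball 0 1) p \<subseteq> above"
    by (auto simp: upper_boundary_def above_def frontier_def interior_open)
  then have "above \<noteq> {}"
    using False by auto
  then obtain c where c: "c \<ge> 1" "\<And>t. 0 \<le> t \<Longrightarrow> \<exists>w\<in>below. dist (p - of_real t) w \<le> c * gap t"
    using gap_below_le by blast
  show ?thesis
  proof (rule that[OF c(1)])
    fix t :: real assume t: "0 \<le> t"
    define z where "z = p - of_real t"
    obtain w where w: "w \<in> below" "dist z w \<le> c * gap t"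
      using c(2)[OF t] by (auto simp: z_def)
    obtain v where v: "0 < v" "v \<le> 1" "z + v *\<^sub>R (w - z) \<in> frontier (h ` ball 0 1)"
      using frontier_on_segment[OF op, of z w] orbit_in_image[OF t] w(1)
      by (auto simp: z_def below_def)
    have "Im (z + v *\<^sub>R (w - z)) < Im p"
      using w(1) v(1) by (simp add: z_def below_def mult_pos_neg)
    then have lower: "z + v *\<^sub>R (w - z) \<in> lower_boundary (h ` ball 0 1) p"
      using v(3) by (simp add: lower_boundary_def)
    then have "infdist z (lower_boundary (h ` ball 0 1) p) \<le> dist z (z + v *\<^sub>R (w - z))"
      by (rule infdist_le)
    also have "\<dots> \<le> dist z w"
      using v(1,2) by (simp add: dist_norm norm_minus_commute mult_left_le_one_le)
    also have "\<dots> \<le> c * infdist z (upper_boundary (h ` ball 0 1) p)"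
      using w(2) c(1) infdist_mono[OF sub False, of z]
      by (auto simp: gap_def z_def intro: order_trans mult_left_mono)
    finally show "delta_minus (h ` ball 0 1) p (p - of_real t)
        \<le> ereal c * delta_plus (h ` ball 0 1) p (p - of_real t)"
      using lower False by (auto simp: delta_minus_def delta_plus_def ext_dist_def z_def)
  qed
qed

end

section \<open>Reflection in the real axis\<close>

lemma cnj_unit_disc: "cnj ` unit_disc = unit_disc"
  by (auto simp: image_cnj_conv_vimage_cnj)

lemma frontier_cnj: "frontier (cnj ` S) = cnj ` frontier S"
proof -
  have "linear cnj" "inj cnj"
    using bounded_linear_cnj by (auto simp: bounded_linear.linear inj_on_def)
  then show ?thesis
    unfolding frontier_def
    by (simp add: closure_injective_linear_image interior_injective_linear_image image_set_diff)
qed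

lemma ext_dist_cnj: "ext_dist (cnj z) (cnj ` A) = ext_dist z A"
proof -
  have "dist (cnj z) (cnj a) = dist z a" for a
    by (simp add: dist_norm flip: complex_cnj_diff)
  then show ?thesis
    by (simp add: ext_dist_def infdist_def image_image)
qed

lemma lower_boundary_cnj: "lower_boundary (cnj ` \<Omega>) (cnj p) = cnj ` upper_boundary \<Omega> p"
  by (auto simp: lower_boundary_def upper_boundary_def frontier_cnj)

lemma upper_boundary_cnj: "upper_boundary (cnj ` \<Omega>) (cnj p) = cnj ` lower_boundary \<Omega> p"
  by (auto simp: lower_boundary_def upper_boundary_def frontier_cnj)

text \<open>Conjugation commutes with real translations and exchanges the two sides of the line, so
  \<open>delta_minus_le_delta_plus\<close> for the reflected orbit is the missing
  inequality.\<close>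

lemma (in horizontal_orbit) horizontal_orbit_cnj:
  "horizontal_orbit (cnj \<circ> h \<circ> cnj) (\<lambda>t. cnj (u t)) (cnj p) (cnj \<sigma>) M T"
proof
  show "cnj \<circ> h \<circ> cnj holomorphic_on ball 0 1"
    by (rule holomorphic_on_compose_cnj_cnj) (use holh in \<open>auto simp: cnj_unit_disc\<close>)
  show "inj_on (cnj \<circ> h \<circ> cnj) (ball 0 1)"
  proof (rule inj_onI)
    fix x y assume "x \<in> ball 0 1" "y \<in> ball 0 1" "(cnj \<circ> h \<circ> cnj) x = (cnj \<circ> h \<circ> cnj) y"
    then have "cnj x = cnj y"
      using inj_onD[OF injh, of "cnj x" "cnj y"] by simp
    then show "x = y"
      by simp
  qed
  have im: "(cnj \<circ> h \<circ> cnj) ` ball 0 1 = cnj ` h ` ball 0 1"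
    by (metis cnj_unit_disc image_comp)
  show "w + of_real s \<in> (cnj \<circ> h \<circ> cnj) ` ball 0 1"
    if "w \<in> (cnj \<circ> h \<circ> cnj) ` ball 0 1" "0 \<le> s" for w s
    using that translate[of "cnj w" s] unfolding im by (simp add: image_cnj_conv_vimage_cnj)
  show "dist (cnj \<sigma>) (cnj (u t)) \<le> M * (1 - norm (cnj (u t)))" if "T \<le> t" for t
    using stolz[OF that] by (simp add: dist_norm flip: complex_cnj_diff)
qed (use u_disc h_u M T in auto)

lemma (in horizontal_orbit) delta_plus_le_delta_minus:
  obtains c where "c \<ge> 1"
    "\<And>t. 0 \<le> t \<Longrightarrow> delta_plus (h ` ball 0 1) p (p - of_real t)
        \<le> ereal c * delta_minus (h ` ball 0 1) p (p - of_real t)"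
proof -
  interpret conj: horizontal_orbit "cnj \<circ> h \<circ> cnj" "\<lambda>t. cnj (u t)" "cnj p" "cnj \<sigma>" M T
    by (rule horizontal_orbit_cnj)
  have im: "(cnj \<circ> h \<circ> cnj) ` ball 0 1 = cnj ` h ` ball 0 1"
    by (metis cnj_unit_disc image_comp)
  have z: "cnj p - of_real t = cnj (p - of_real t)" for t
    by simp
  obtain c where "c \<ge> 1" "\<And>t. 0 \<le> t \<Longrightarrow>
      delta_minus (cnj ` h ` ball 0 1) (cnj p) (cnj p - of_real t)
        \<le> ereal c * delta_plus (cnj ` h ` ball 0 1) (cnj p) (cnj p - of_real t)"
    using conj.delta_minus_le_delta_plus unfolding im by blast
  then show ?thesis
    using that unfolding delta_minus_def delta_plus_def lower_boundary_cnj upper_boundary_cnj z ext_dist_cnj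
    by blast
qed

section \<open>Application to the semigroup\<close>

lemma ext_dist_nonneg: "0 \<le> ext_dist z A"
  by (simp add: ext_dist_def infdist_nonneg)

theorem theorem1p2:
  fixes \<phi> :: "real \<Rightarrow> complex \<Rightarrow> complex"
    and h :: "complex \<Rightarrow> complex"
    and \<gamma> :: "real \<Rightarrow> complex"
    and \<sigma> :: complex
    and \<Omega> :: "complex set"
  assumes "non_elliptic_semigroup \<phi>"
    and "is_Koenigs_function \<phi> h"
    and "backward_orbit \<phi> \<gamma>"
    and "\<sigma> \<in> sphere 0 1"
    and "converges_nontangentially \<gamma> \<sigma>"
    and "\<Omega> = h ` unit_disc"
  shows "\<exists>c::real. c \<ge> 1 \<and>
    (\<forall>t\<ge>0. ereal (1 / c) * delta_minus \<Omega> (h (\<gamma> 0)) (h (\<gamma> t))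
              \<le> delta_plus \<Omega> (h (\<gamma> 0)) (h (\<gamma> t)) \<and>
            delta_plus \<Omega> (h (\<gamma> 0)) (h (\<gamma> t))
              \<le> ereal c * delta_minus \<Omega> (h (\<gamma> 0)) (h (\<gamma> t)))"
proof -
  note koenigs = assms(2)[unfolded is_Koenigs_function_def]
  note orbit = assms(3)[unfolded backward_orbit_def]
  obtain M T where M: "M > 1" and T: "\<And>t. T \<le> t \<Longrightarrow> \<gamma> t \<in> stolz_angle \<sigma> M"
    using assms(5) by (auto simp: converges_nontangentially_def eventually_at_top_linorder)
  have disc: "\<gamma> t \<in> unit_disc" if "0 \<le> t" for t
    using orbit that by auto
  have line: "h (\<gamma> t) = h (\<gamma> 0) - of_real t" if t: "0 \<le> t" for t
  proof (cases "t = 0")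
    case False
    \<comment> \<open>Flowing forward for the full time \<open>t\<close> returns to the starting
      point; applying \<open>h\<close> then linearizes the flow.\<close>
    have "\<phi> t (\<gamma> t) = \<gamma> (t - t)"
      using orbit t False by (simp del: diff_self)
    then have "\<gamma> 0 = inv_into unit_disc h (h (\<gamma> t) + of_real t)"
      using koenigs disc[OF t] t by simp
    moreover have "h (\<gamma> t) + of_real t \<in> h ` unit_disc"
      using koenigs disc[OF t] t by blast
    ultimately show ?thesis
      by (simp add: f_inv_into_f)
  qed simp
  \<comment> \<open>The threshold \<open>T\<close> for the Stolz angle may be negative, whereas the
    locale needs a nonnegative one.\<close>
  interpret horizontal_orbit h \<gamma> "h (\<gamma> 0)" \<sigma> M "max 0 T"
  proof
    show "h holomorphic_on unit_disc" "inj_on h unit_disc"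
      using koenigs by simp_all
    show "w + of_real s \<in> h ` unit_disc" if "w \<in> h ` unit_disc" "0 \<le> s" for w s
      using koenigs that by blast
    show "dist \<sigma> (\<gamma> t) \<le> M * (1 - norm (\<gamma> t))" if "max 0 T \<le> t" for t
      using T[of t] that by (simp add: stolz_angle_def dist_norm)
  qed (rule disc line | use M in simp)+
  obtain c1 where c1: "c1 \<ge> 1" "\<And>t. 0 \<le> t \<Longrightarrow> delta_minus \<Omega> (h (\<gamma> 0)) (h (\<gamma> t))
      \<le> ereal c1 * delta_plus \<Omega> (h (\<gamma> 0)) (h (\<gamma> t))"
    using delta_minus_le_delta_plus unfolding assms(6) by (metis line)
  obtain c2 where c2: "c2 \<ge> 1" "\<And>t. 0 \<le> t \<Longrightarrow> delta_plus \<Omega> (h (\<gamma> 0)) (h (\<gamma> t))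
      \<le> ereal c2 * delta_minus \<Omega> (h (\<gamma> 0)) (h (\<gamma> t))"
    using delta_plus_le_delta_minus unfolding assms(6) by (metis line)
  define c where "c = max c1 c2"
  have c: "c \<ge> 1"
    using c1(1) by (simp add: c_def)
  show ?thesis
  proof (intro exI[of _ c] conjI allI impI c)
    fix t :: real assume t: "0 \<le> t"
    let ?m = "delta_minus \<Omega> (h (\<gamma> 0)) (h (\<gamma> t))" and ?p = "delta_plus \<Omega> (h (\<gamma> 0)) (h (\<gamma> t))"
    have nonneg: "0 \<le> ?m" "0 \<le> ?p"
      by (simp_all add: delta_minus_def delta_plus_def ext_dist_nonneg)
    have "ereal c2 * ?m \<le> ereal c * ?m"
      using nonneg by (intro ereal_mult_right_mono) (auto simp: c_def)
    then show "?p \<le> ereal c * ?m"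
      using c2(2)[OF t] by (rule order_trans[rotated])
    have "?m \<le> ereal c * ?p"
      using c1(2)[OF t] ereal_mult_right_mono[of "ereal c1" "ereal c" ?p] nonneg
      by (auto simp: c_def intro: order_trans)
    then have "ereal (1 / c) * ?m \<le> ereal (1 / c) * (ereal c * ?p)"
      using c by (intro ereal_mult_left_mono) auto
    \<comment> \<open>The finite constants cancel by associativity, even where the distance is
      infinite.\<close>
    also have "\<dots> = ?p"
      using c by (simp add: mult.assoc[symmetric])
    finally show "ereal (1 / c) * ?m \<le> ?p" .
  qed
qed

end
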